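(* For every $n\ge1$ there exist constants $a_n,b_n,c_n,d_n$ (independent of $z$) such that $$zX_n(z)=a_nY_{-n-1}(z)+b_nX_n(z)+c_nY_{-n}(z)+d_nX_{n-1}(z).$$
   Context: Standing assumptions: $0<q<1$; $\mathbf t=(t_1,t_2,t_3,t_4)$ with each $t_i$ real and $|t_i|<1$. Notation: $(a;q)_k=\prod_{i=0}^{k-1}(1-aq^i)$, $(a_1,\dots,a_r;q)_k=\prod_j(a_j;q)_k$, and ${}_4\phi_3(a_1,a_2,a_3,a_4;b_1,b_2,b_3;q,q)=\sum_{k\ge 0}\frac{(a_1,a_2,a_3,a_4;q)_k}{(q,b_1,b_2,b_3;q)_k}q^k$. $R_n={}_4\phi_3(q^{-n},t_1t_2t_3t_4q^{n-1},t_1z,t_1/z;\;t_1t_2,t_1t_3,t_1t_4;q,q)$ for $n\ge0$; $S_0=0$ and for $n\ge1$, $S_n=z(1-t_3/z)(1-t_4/z)\;{}_4\phi_3(q^{1-n},t_1t_2t_3t_4q^{n},t_1z,qt_1/z;\;qt_1t_2,qt_1t_3,qt_1t_4;q,q)$. These are Laurent polynomials in $z$. Define the Laurent polynomials $X_{n}=(1-t_1t_2)(1-t_1t_3)(1-t_1t_4)R_n+t_1^2t_2(1-q^{n})S_n$ for $n\ge0$, $Y_{-n}=q^{n-1}t_3t_4(1-t_1t_2)(1-t_1t_3)(1-t_1t_4)R_n-t_1(1-t_1t_2t_3t_4q^{n-1})S_n$ for $n>0$. *)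

theory Defs
  imports "HOL-Analysis.Analysis"
begin

definition qpoch :: "real \<Rightarrow> complex \<Rightarrow> nat \<Rightarrow> complex" where
  "qpoch q a k = (\<Prod>i<k. 1 - a * of_real q ^ i)"

text \<open>The series with argument equal to the base. In all uses below one upper parameter
  is a power of \<open>q\<close> with nonpositive integer exponent, so the sum has finite support.\<close>

definition phi43 ::
  "real \<Rightarrow> complex \<Rightarrow> complex \<Rightarrow> complex \<Rightarrow> complex \<Rightarrow> complex \<Rightarrow> complex \<Rightarrow> complex \<Rightarrow> complex"
where
  "phi43 q a1 a2 a3 a4 b1 b2 b3 =
     (\<Sum>k. qpoch q a1 k * qpoch q a2 k * qpoch q a3 k * qpoch q a4 k
            / (qpoch q (of_real q) k * qpoch q b1 k * qpoch q b2 k * qpoch q b3 k)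
            * of_real q ^ k)"

text \<open>Laurent polynomials in \<open>z\<close> are represented by their values; these are meaningful
  only for \<open>z \<noteq> 0\<close>.\<close>

definition R :: "real \<Rightarrow> real \<Rightarrow> real \<Rightarrow> real \<Rightarrow> real \<Rightarrow> nat \<Rightarrow> complex \<Rightarrow> complex" where
  "R q t1 t2 t3 t4 n z =
     phi43 q (of_real (q powi (- int n))) (of_real (t1 * t2 * t3 * t4 * q powi (int n - 1)))
       (of_real t1 * z) (of_real t1 / z)
       (of_real (t1 * t2)) (of_real (t1 * t3)) (of_real (t1 * t4))"

definition S :: "real \<Rightarrow> real \<Rightarrow> real \<Rightarrow> real \<Rightarrow> real \<Rightarrow> nat \<Rightarrow> complex \<Rightarrow> complex" where
  "S q t1 t2 t3 t4 n z =
     (if n = 0 then 0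
      else z * (1 - of_real t3 / z) * (1 - of_real t4 / z) *
        phi43 q (of_real (q powi (1 - int n))) (of_real (t1 * t2 * t3 * t4 * q ^ n))
          (of_real t1 * z) (of_real (q * t1) / z)
          (of_real (q * t1 * t2)) (of_real (q * t1 * t3)) (of_real (q * t1 * t4)))"

definition X :: "real \<Rightarrow> real \<Rightarrow> real \<Rightarrow> real \<Rightarrow> real \<Rightarrow> nat \<Rightarrow> complex \<Rightarrow> complex" where
  "X q t1 t2 t3 t4 n z =
     of_real ((1 - t1 * t2) * (1 - t1 * t3) * (1 - t1 * t4)) * R q t1 t2 t3 t4 n z
     + of_real (t1\<^sup>2 * t2 * (1 - q ^ n)) * S q t1 t2 t3 t4 n z"

text \<open>\<open>Yneg \<dots> n\<close> is the Laurent polynomial \<open>Y\<close> with index \<open>-n\<close>; only \<open>n > 0\<close> is meaningful.\<close>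

definition Yneg :: "real \<Rightarrow> real \<Rightarrow> real \<Rightarrow> real \<Rightarrow> real \<Rightarrow> nat \<Rightarrow> complex \<Rightarrow> complex" where
  "Yneg q t1 t2 t3 t4 n z =
     of_real (q ^ (n - 1) * t3 * t4 * (1 - t1 * t2) * (1 - t1 * t3) * (1 - t1 * t4))
       * R q t1 t2 t3 t4 n z
     - of_real (t1 * (1 - t1 * t2 * t3 * t4 * q ^ (n - 1))) * S q t1 t2 t3 t4 n z"

end

theory Submission
  imports Defs
begin

text \<open>
  Write \<open>N = q ^ n\<close>, \<open>K = q ^ k\<close>, \<open>A = t1 t2\<close>, \<open>B = t1 t3\<close>, \<open>C = t1 t4\<close>, \<open>W = t3 t4\<close>, \<open>T = A W\<close> and
  expand everything in the basis \<open>theta k = (t1 z;q)_k (q t1/z;q)_k\<close>,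
  \<open>eta k = (t1 z;q)_(k+1) (q t1/z;q)_k\<close>. The particular combinations of \<open>R n\<close> and \<open>S n\<close> in the
  definitions make the coefficients of \<open>X n\<close> and \<open>Y (-n-1)\<close> collapse to single hypergeometric terms:
  with \<open>D k = (1 - B K) (1 - C K)\<close> and
  \<open>tau n k = (1/N;q)_k (T N;q)_k / (q, q A, B, C;q)_k\<close>, both are multiples of sums
  \<open>\<Sum> tau n k (theta k - (1 - c K) / D k eta k)\<close>, where \<open>c = 1/N\<close> for \<open>X n\<close> and \<open>c = T N\<close> for
  \<open>Y (-n-1)\<close>. Since \<open>T N \<noteq> 1/N\<close>, they span the same space as
  \<open>U n = \<Sum> tau n k (theta k - eta k / D k)\<close> and \<open>V n = \<Sum> tau n k K / D k eta k\<close>.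
  Multiplication by \<open>t1 z\<close> is three-term on the basis, and comparing coefficients, membership of
  \<open>t1 z (U n + V n / N)\<close> in the span of \<open>U n\<close>, \<open>V n\<close>, \<open>U (n-1)\<close>, \<open>V (n-1)\<close> reduces to the fact that
  \<open>1 - T N K / q\<close> and \<open>1 - K / N\<close> span the affine functions of \<open>K\<close>. For \<open>t1 = 0\<close> the argument
  breaks down, but then \<open>X n = 0\<close> by a terminating q-binomial sum.
\<close>


section \<open>q-shifted factorials and terminating sums\<close>

definition rpoch :: "real \<Rightarrow> real \<Rightarrow> nat \<Rightarrow> real" where
  "rpoch q a k = (\<Prod>i<k. 1 - a * q ^ i)"

text \<open>All parameters are real and only \<open>z\<close> is complex, so coefficient identities
  are proved over the reals and transferred by this embedding.\<close>

lemma qpoch_of_real: "qpoch q (of_real a) k = of_real (rpoch q a k)"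
  by (simp add: qpoch_def rpoch_def)

lemma rpoch_0 [simp]: "rpoch q a 0 = 1"
  and rpoch_Suc: "rpoch q a (Suc k) = rpoch q a k * (1 - a * q ^ k)"
  by (simp_all add: rpoch_def)

lemma rpoch_shift: "(1 - a) * rpoch q (q * a) k = rpoch q a k * (1 - a * q ^ k)"
proof (induction k)
  case (Suc k)
  have "(1 - a) * rpoch q (q * a) (Suc k) = ((1 - a) * rpoch q (q * a) k) * (1 - q * a * q ^ k)"
    by (simp add: rpoch_Suc)
  then show ?case unfolding Suc.IH by (simp add: rpoch_Suc mult_ac)
qed simp

lemma qpoch_0 [simp]: "qpoch q a 0 = 1"
  and qpoch_Suc: "qpoch q a (Suc k) = qpoch q a k * (1 - a * of_real q ^ k)"
  by (simp_all add: qpoch_def)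

lemma qpoch_shift:
  "(1 - a) * qpoch q (of_real q * a) k = qpoch q a k * (1 - a * of_real q ^ k)"
proof (induction k)
  case (Suc k)
  have "(1 - a) * qpoch q (of_real q * a) (Suc k)
      = ((1 - a) * qpoch q (of_real q * a) k) * (1 - of_real q * a * of_real q ^ k)"
    by (simp add: qpoch_Suc)
  then show ?case unfolding Suc.IH by (simp add: qpoch_Suc mult_ac)
qed simp

lemma one_minus_mult_power_nonzero:
  fixes a q :: real
  assumes "0 < q" "q < 1" "\<bar>a\<bar> < 1"
  shows "1 - a * q ^ k \<noteq> 0"
proof -
  have "\<bar>a * q ^ k\<bar> \<le> \<bar>a\<bar> * 1"
    unfolding abs_mult using assms by (intro mult_left_mono) (auto simp: power_le_one)
  then show ?thesis using assms by auto
qed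

lemma rpoch_nonzero:
  assumes "0 < q" "q < 1" "\<bar>a\<bar> < 1"
  shows "rpoch q a k \<noteq> 0"
  using one_minus_mult_power_nonzero[OF assms] by (simp add: rpoch_def)

lemma rpoch_inverse_power_eq_0:
  assumes "0 < q" "n < k"
  shows "rpoch q (1 / q ^ n) k = 0"
  using assms by (auto simp: rpoch_def)

text \<open>For \<open>k > n\<close> the first upper parameter contributes a zero factor, so the
  quotient vanishes whatever its denominator is.\<close>

lemma phi43_finite:
  assumes "0 < q"
  shows "phi43 q (of_real (1 / q ^ n)) a2 a3 a4 b1 b2 b3 =
    (\<Sum>k\<le>n. qpoch q (of_real (1 / q ^ n)) k * qpoch q a2 k * qpoch q a3 k * qpoch q a4 k
            / (qpoch q (of_real q) k * qpoch q b1 k * qpoch q b2 k * qpoch q b3 k)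
            * of_real q ^ k)"
  unfolding phi43_def
  by (rule suminf_finite)
     (use assms in \<open>auto simp: qpoch_of_real rpoch_inverse_power_eq_0 simp del: of_real_divide of_real_power\<close>)

text \<open>Used to bring contributions to neighbouring basis elements back to a common index; in
  each use one boundary term dies by a factor \<open>1 - q ^ k\<close> at \<open>k = 0\<close> or by
  a case split there, the other by termination.\<close>

lemma sum_atMost_shift:
  fixes g :: "nat \<Rightarrow> 'a :: comm_monoid_add"
  assumes "g 0 = 0" "g (Suc n) = 0"
  shows "(\<Sum>k\<le>n. g k) = (\<Sum>k\<le>n. g (Suc k))"
proof -
  have "(\<Sum>k\<le>Suc n. g k) = g 0 + (\<Sum>k\<le>n. g (Suc k))"
    by (rule sum.atMost_Suc_shift)
  then show ?thesis using assms by simp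
qed

section \<open>The interlacing basis and multiplication by z\<close>

definition theta :: "real \<Rightarrow> real \<Rightarrow> complex \<Rightarrow> nat \<Rightarrow> complex" where
  "theta q t z k = qpoch q (of_real t * z) k * qpoch q (of_real (q * t) / z) k"

definition eta :: "real \<Rightarrow> real \<Rightarrow> complex \<Rightarrow> nat \<Rightarrow> complex" where
  "eta q t z k = qpoch q (of_real t * z) (Suc k) * qpoch q (of_real (q * t) / z) k"

lemma eta_eq: "eta q t z k = theta q t z k * (1 - of_real t * z * of_real q ^ k)"
  by (simp add: eta_def theta_def qpoch_Suc algebra_simps)

lemma theta_Suc:
  "theta q t z (Suc k) = eta q t z k * (1 - of_real (q * t) / z * of_real q ^ k)"
  by (simp add: eta_def theta_def qpoch_Suc algebra_simps)

lemma mult_theta: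
  assumes "q \<noteq> 0"
  shows "of_real t * z * theta q t z k = (theta q t z k - eta q t z k) / of_real (q ^ k)"
  using assms by (simp add: eta_eq field_simps)

text \<open>By \<open>theta_Suc\<close>, \<open>t z eta k\<close> is
  \<open>t z theta (Suc k)\<close> plus a multiple of \<open>eta k\<close>, since the factor
  \<open>z\<close> cancels \<open>1 / z\<close>; then \<open>mult_theta\<close> applies at
  \<open>Suc k\<close>.\<close>

lemma mult_eta:
  assumes "q \<noteq> 0" "z \<noteq> 0"
  shows "of_real t * z * eta q t z k = of_real (t\<^sup>2 * q * q ^ k) * eta q t z k
     + (theta q t z (Suc k) - eta q t z (Suc k)) / of_real (q ^ Suc k)"
  using assms by (simp add: eta_eq[of _ _ _ "Suc k"] theta_Suc field_simps power2_eq_square)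

text \<open>Splitting off the first factor of \<open>(t/z;q)_k\<close> leaves
  \<open>(1 - t/z) eta (k - 1)\<close>, and \<open>1 - t/z\<close> is a combination of
  \<open>1\<close> and the factor \<open>1 - q^k t/z\<close> that turns \<open>eta (k - 1)\<close>
  into \<open>theta k\<close>.\<close>

lemma phi_expand:
  assumes "q \<noteq> 0" "z \<noteq> 0"
  shows "qpoch q (of_real t * z) k * qpoch q (of_real t / z) k =
    theta q t z k / of_real (q ^ k)
      + (if k = 0 then 0 else (1 - 1 / of_real (q ^ k)) * eta q t z (k - 1))"
proof (cases k)
  case 0
  then show ?thesis by (simp add: theta_def)
next
  case (Suc j)
  have "qpoch q (of_real t / z) (Suc j) = (1 - of_real t / z) * qpoch q (of_real (q * t) / z) j"
    using qpoch_shift[of "of_real t / z" q j] by (simp add: qpoch_Suc)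
  then have "qpoch q (of_real t * z) k * qpoch q (of_real t / z) k
      = (1 - of_real t / z) * eta q t z j"
    by (simp add: Suc eta_def)
  also have "\<dots> = theta q t z k / of_real (q ^ k) + (1 - 1 / of_real (q ^ k)) * eta q t z j"
    using assms by (simp add: Suc theta_Suc field_simps)
  finally show ?thesis by (simp add: Suc)
qed

text \<open>The prefactor is \<open>z - (c + d) + c d / z\<close>, resolved along \<open>1\<close>,
  \<open>1 - t z q^k\<close> and the product of the latter with \<open>1 - q t q^k / z\<close>. The
  extra factor \<open>t\<close> keeps the coefficients free of division by \<open>t\<close>.\<close>

lemma sigma_expand:
  assumes "q \<noteq> 0" "z \<noteq> 0"
  shows "of_real t * (z * (1 - of_real c / z) * (1 - of_real d / z) * theta q t z k) =
    of_real ((1 - t * c * q ^ k) * (1 - t * d * q ^ k) / q ^ k) * theta q t z k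
    + of_real ((c * d - q) / (q ^ Suc k)) * eta q t z k
    - of_real (c * d / q ^ Suc k) * theta q t z (Suc k)"
  using assms by (simp add: theta_Suc eta_eq field_simps power2_eq_square)

lemma sum_q_binomial:
  assumes "0 < q" "q < 1"
  shows "(\<Sum>k\<le>n. rpoch q a k / rpoch q q k * q ^ k) = rpoch q (q * a) n / rpoch q q n"
proof (induction n)
  case (Suc n)
  have nz: "rpoch q q n \<noteq> 0" "1 - q * q ^ n \<noteq> 0"
    using assms rpoch_nonzero[of q q n] one_minus_mult_power_nonzero[of q q n] by auto
  have "rpoch q a (Suc n) = (1 - a) * rpoch q (q * a) n"
    by (simp add: rpoch_shift rpoch_Suc)
  then have "(\<Sum>k\<le>Suc n. rpoch q a k / rpoch q q k * q ^ k)
      = rpoch q (q * a) n / rpoch q q n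
        + (1 - a) * rpoch q (q * a) n / (rpoch q q n * (1 - q * q ^ n)) * (q * q ^ n)"
    using Suc.IH by (simp add: rpoch_Suc)
  also have "\<dots> = rpoch q (q * a) (Suc n) / rpoch q q (Suc n)"
    using nz by (simp add: rpoch_Suc divide_simps) algebra
  finally show ?case .
qed simp

text \<open>The weight of \<open>S\<close> contains \<open>t1\<close> squared, and in
  \<open>R\<close> every parameter except \<open>q^(-n)\<close> becomes zero, which leaves the sum
  evaluated by \<open>sum_q_binomial\<close>.\<close>

lemma X_eq_0:
  assumes "0 < q" "q < 1" "n \<ge> 1"
  shows "X q 0 t2 t3 t4 n z = 0"
proof -
  have one: "qpoch q 0 k = 1" for k by (simp add: qpoch_def)
  have "R q 0 t2 t3 t4 n z = (\<Sum>k\<le>n. of_real (rpoch q (1 / q ^ n) k / rpoch q q k * q ^ k))"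
    using phi43_finite[of q n 0 0 0 0 0 0] assms
    by (simp add: R_def one power_int_minus divide_inverse qpoch_of_real flip: of_real_inverse of_real_power)
  also have "\<dots> = of_real (rpoch q (q * (1 / q ^ n)) n / rpoch q q n)"
    unfolding of_real_sum[symmetric] sum_q_binomial[OF assms(1,2)] ..
  \<comment> \<open>The parameter is \<open>q^(1-n)\<close>, so the factor with index
    \<open>n - 1\<close> is zero.\<close>
  also have "rpoch q (q * (1 / q ^ n)) n = 0"
    using assms rpoch_inverse_power_eq_0[of q "n - 1" n] by (cases n) auto
  finally show ?thesis by (simp add: X_def)
qed


section \<open>Parameters and coefficient sequences\<close>

locale aw_params =
  fixes q t1 t2 t3 t4 :: real
  assumes q: "0 < q" "q < 1"
    and t: "\<bar>t1\<bar> < 1" "\<bar>t2\<bar> < 1" "\<bar>t3\<bar> < 1" "\<bar>t4\<bar> < 1"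
begin

definition A :: real where "A = t1 * t2"
definition B :: real where "B = t1 * t3"
definition C :: real where "C = t1 * t4"
definition W :: real where "W = t3 * t4"
definition T :: real where "T = A * W"

lemma abs_less_1: "\<bar>A\<bar> < 1" "\<bar>B\<bar> < 1" "\<bar>C\<bar> < 1" "\<bar>W\<bar> < 1" "\<bar>T\<bar> < 1"
proof -
  have *: "\<bar>x * y\<bar> < 1" if "\<bar>x\<bar> < 1" "\<bar>y\<bar> < 1" for x y :: real
    using mult_strict_mono'[of "\<bar>x\<bar>" 1 "\<bar>y\<bar>" 1] that by (simp add: abs_mult)
  show "\<bar>A\<bar> < 1" "\<bar>B\<bar> < 1" "\<bar>C\<bar> < 1" "\<bar>W\<bar> < 1"
    unfolding A_def B_def C_def W_def using t * by blast+
  then show "\<bar>T\<bar> < 1" unfolding T_def using * by blast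
qed

lemma abs_q_mult_less_1: "\<bar>x\<bar> < 1 \<Longrightarrow> \<bar>q * x\<bar> < 1"
  using q mult_strict_mono'[of q 1 "\<bar>x\<bar>" 1] by (simp add: abs_mult)

lemma q_power_nonzero: "q ^ k \<noteq> 0" and q_nonzero: "q \<noteq> 0"
  using q by auto

lemma q_power_Suc_neq_1: "q ^ Suc k \<noteq> 1"
  using q by (metis less_irrefl power_Suc_less_one)

lemmas factor_nonzero = one_minus_mult_power_nonzero[OF q]
lemmas rpoch_neq_0 = rpoch_nonzero[OF q]

text \<open>Normalised coefficients of \<open>R\<close> of degree \<open>Suc m\<close>; indexing by
  \<open>m\<close> writes \<open>T q^(n-1)\<close> as \<open>T * q ^ m\<close> without
  subtraction.\<close>

definition rho :: "nat \<Rightarrow> nat \<Rightarrow> real" where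
  "rho m k = (1 - A) * (1 - B) * (1 - C) *
     (rpoch q (1 / q ^ Suc m) k * rpoch q (T * q ^ m) k
      / (rpoch q q k * rpoch q A k * rpoch q B k * rpoch q C k) * q ^ k)"

text \<open>Coefficients of the series in \<open>S\<close> of degree \<open>Suc m\<close>.\<close>

definition sig :: "nat \<Rightarrow> nat \<Rightarrow> real" where
  "sig m k = rpoch q (1 / q ^ m) k * rpoch q (T * q ^ Suc m) k
      / (rpoch q q k * rpoch q (q * A) k * rpoch q (q * B) k * rpoch q (q * C) k) * q ^ k"

definition tau :: "nat \<Rightarrow> nat \<Rightarrow> real" where
  "tau n k = rpoch q (1 / q ^ n) k * rpoch q (T * q ^ n) k
      / (rpoch q q k * rpoch q (q * A) k * rpoch q B k * rpoch q C k)"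

lemma rpoch_shift_inverse:
  assumes "\<bar>a\<bar> < 1"
  shows "(1 - a) / rpoch q a k = (1 - a * q ^ k) / rpoch q (q * a) k"
  using rpoch_shift[of a q k] rpoch_neq_0[OF assms, of k]
    rpoch_neq_0[OF abs_q_mult_less_1[OF assms], of k]
  by (simp add: frac_eq_eq)

lemma rpoch_T_shift:
  "rpoch q (T * q ^ m) k * (1 - T * q ^ m * q ^ k) = (1 - T * q ^ m) * rpoch q (T * q ^ Suc m) k"
  using rpoch_shift[of "T * q ^ m" q k] by (simp add: mult_ac)

lemma rpoch_N_shift:
  "rpoch q (1 / q ^ Suc m) k * (1 - q ^ k / q ^ Suc m) = (1 - 1 / q ^ Suc m) * rpoch q (1 / q ^ m) k"
  using rpoch_shift[of "1 / q ^ Suc m" q k] q by simp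

lemma rho_Suc:
  "rho m (Suc k) * ((1 - q * q ^ k) * (1 - A * q ^ k) * ((1 - B * q ^ k) * (1 - C * q ^ k)))
    = rho m k * (1 - q ^ k / q ^ Suc m) * (1 - T * q ^ m * q ^ k) * q"
  using factor_nonzero[of q k] factor_nonzero[of A k] factor_nonzero[of B k] factor_nonzero[of C k]
    abs_less_1 q
  by (simp add: rho_def rpoch_Suc mult_ac)

text \<open>The extra factor moves \<open>T q^m\<close> to \<open>T q^(m+1)\<close>, giving
  \<open>tau (Suc m)\<close>. In \<open>rho_tau'\<close> it moves \<open>q^(-m-1)\<close> to
  \<open>q^(-m)\<close> instead, giving \<open>tau m\<close>. These two options separate
  \<open>X\<close> from \<open>Y\<close>.\<close>

lemma rho_tau:
  "rho m k * (1 - T * q ^ m * q ^ k)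
    = (1 - B) * (1 - C) * (1 - T * q ^ m) * q ^ k * (1 - A * q ^ k) * tau (Suc m) k"
proof -
  have "rho m k * (1 - T * q ^ m * q ^ k) = ((1 - A) / rpoch q A k) * (1 - B) * (1 - C) *
      (rpoch q (T * q ^ m) k * (1 - T * q ^ m * q ^ k)) * q ^ k * rpoch q (1 / q ^ Suc m) k
      / (rpoch q q k * rpoch q B k * rpoch q C k)"
    by (simp add: rho_def mult_ac)
  also have "\<dots> = (1 - B) * (1 - C) * (1 - T * q ^ m) * q ^ k * (1 - A * q ^ k) * tau (Suc m) k"
    unfolding rpoch_T_shift rpoch_shift_inverse[OF abs_less_1(1)] by (simp add: tau_def mult_ac)
  finally show ?thesis .
qed

lemma rho_tau':
  "rho m k * (1 - q ^ k / q ^ Suc m)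
    = (1 - B) * (1 - C) * (1 - 1 / q ^ Suc m) * q ^ k * (1 - A * q ^ k) * tau m k"
proof -
  have "rho m k * (1 - q ^ k / q ^ Suc m) = ((1 - A) / rpoch q A k) * (1 - B) * (1 - C) *
      (rpoch q (1 / q ^ Suc m) k * (1 - q ^ k / q ^ Suc m)) * q ^ k * rpoch q (T * q ^ m) k
      / (rpoch q q k * rpoch q B k * rpoch q C k)"
    by (simp add: rho_def mult_ac)
  also have "\<dots> = (1 - B) * (1 - C) * (1 - 1 / q ^ Suc m) * q ^ k * (1 - A * q ^ k) * tau m k"
    unfolding rpoch_N_shift rpoch_shift_inverse[OF abs_less_1(1)] by (simp add: tau_def mult_ac)
  finally show ?thesis .
qed

text \<open>All parameters of \<open>S\<close> are those of \<open>R\<close> shifted by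
  \<open>q\<close>, so up to a constant independent of \<open>k\<close> its coefficients are those
  of \<open>R\<close> at \<open>Suc k\<close>.\<close>

lemma sig_rho:
  "sig m k * (q * (1 - 1 / q ^ Suc m) * (1 - T * q ^ m)) = rho m (Suc k) * (1 - q * q ^ k)"
proof -
  have "rho m (Suc k) * (1 - q * q ^ k) =
      (rho m k * (1 - q ^ k / q ^ Suc m) * (1 - T * q ^ m * q ^ k) * q)
       / ((1 - A * q ^ k) * ((1 - B * q ^ k) * (1 - C * q ^ k)))"
    using rho_Suc[of m k] factor_nonzero[of A k] factor_nonzero[of B k] factor_nonzero[of C k]
      abs_less_1 by (simp add: nonzero_eq_divide_eq mult_ac)
  also have "\<dots> = ((1 - A) / rpoch q A k) * ((1 - B) / rpoch q B k) * ((1 - C) / rpoch q C k) *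
      (rpoch q (1 / q ^ Suc m) k * (1 - q ^ k / q ^ Suc m)) *
      (rpoch q (T * q ^ m) k * (1 - T * q ^ m * q ^ k)) * q ^ k * q
       / (rpoch q q k * ((1 - A * q ^ k) * ((1 - B * q ^ k) * (1 - C * q ^ k))))"
    by (simp add: rho_def mult_ac)
  also have "\<dots> = sig m k * (q * (1 - 1 / q ^ Suc m) * (1 - T * q ^ m))"
    unfolding rpoch_T_shift rpoch_N_shift rpoch_shift_inverse[OF abs_less_1(1)]
      rpoch_shift_inverse[OF abs_less_1(2)] rpoch_shift_inverse[OF abs_less_1(3)]
    using factor_nonzero[of A k] factor_nonzero[of B k] factor_nonzero[of C k] abs_less_1
    by (simp add: sig_def mult_ac)
  finally show ?thesis ..
qed

lemma tau_eq_0: "n < k \<Longrightarrow> tau n k = 0"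
  using q by (simp add: tau_def rpoch_inverse_power_eq_0)

lemma rho_eq_0: "Suc m < k \<Longrightarrow> rho m k = 0"
  unfolding rho_def using rpoch_inverse_power_eq_0[OF q(1), of "Suc m" k] by simp

lemma sig_eq_0: "m < k \<Longrightarrow> sig m k = 0"
  using q by (simp add: sig_def rpoch_inverse_power_eq_0)

section \<open>Expansions of R and S in the basis\<close>

abbreviation "th \<equiv> theta q t1"
abbreviation "et \<equiv> eta q t1"

lemma R_expand:
  assumes "z \<noteq> 0"
  shows "of_real ((1 - A) * (1 - B) * (1 - C)) * R q t1 t2 t3 t4 (Suc m) z =
    (\<Sum>k\<le>Suc m. of_real (rho m k / q ^ k) * th z k
       + of_real (rho m (Suc k) * (1 - 1 / q ^ Suc k)) * et z k)"
proof -
  have "of_real ((1 - A) * (1 - B) * (1 - C)) * R q t1 t2 t3 t4 (Suc m) z =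
    (\<Sum>k\<le>Suc m. of_real (rho m k) * (qpoch q (of_real t1 * z) k * qpoch q (of_real t1 / z) k))"
  proof -
    have pw: "q powi (- int (Suc m)) = 1 / q ^ Suc m" "q powi (int (Suc m) - 1) = q ^ m"
      by (simp_all add: power_int_minus divide_inverse del: of_nat_Suc power_Suc) simp
    show ?thesis
      unfolding R_def pw phi43_finite[OF q(1)] sum_distrib_left rho_def
      unfolding A_def[symmetric] B_def[symmetric] C_def[symmetric] qpoch_of_real
      by (intro sum.cong refl) (simp add: T_def A_def W_def mult_ac)
  qed
  also have "\<dots> = (\<Sum>k\<le>Suc m. of_real (rho m k / q ^ k) * th z k) +
     (\<Sum>k\<le>Suc m. if k = 0 then 0 else of_real (rho m k * (1 - 1 / q ^ k)) * et z (k - 1))"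
    unfolding phi_expand[OF q_nonzero assms] sum.distrib[symmetric]
    by (intro sum.cong refl) (simp add: distrib_left)
  also have "(\<Sum>k\<le>Suc m. if k = 0 then 0 else of_real (rho m k * (1 - 1 / q ^ k)) * et z (k - 1))
     = (\<Sum>k\<le>Suc m. of_real (rho m (Suc k) * (1 - 1 / q ^ Suc k)) * et z k)"
    by (subst sum_atMost_shift) (simp_all add: rho_eq_0)
  finally show ?thesis by (simp add: sum.distrib)
qed

text \<open>The factor \<open>t1\<close> on the left is the one \<open>sigma_expand\<close> asks for
  and the rest of the constant comes from \<open>sig_rho\<close>; both \<open>R\<close> and
  \<open>S\<close> are now written through \<open>rho m\<close>.\<close>

lemma S_expand:
  assumes "z \<noteq> 0"
  shows "of_real (q * (1 - 1 / q ^ Suc m) * (1 - T * q ^ m) * t1) * S q t1 t2 t3 t4 (Suc m) z =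
    (\<Sum>k\<le>Suc m. of_real (rho m (Suc k) * (1 - q * q ^ k) * ((1 - B * q ^ k) * (1 - C * q ^ k)) / q ^ k
          - W * rho m k * (1 - q ^ k) / q ^ k) * th z k
       + of_real (rho m (Suc k) * (1 - q * q ^ k) * (W - q) / q ^ Suc k) * et z k)"
    (is "of_real (?c * t1) * _ = _")
proof -
  have collect: "of_real a * x + y - of_real b * x = of_real (a - b) * x + y"
    for a b :: real and x y :: complex
    by (simp add: left_diff_distrib)
  have "of_real t1 * S q t1 t2 t3 t4 (Suc m) z =
    (\<Sum>k\<le>m. of_real (sig m k) *
      (of_real t1 * (z * (1 - of_real t3 / z) * (1 - of_real t4 / z) * th z k)))"
  proof -
    have pw: "q powi (1 - int (Suc m)) = 1 / q ^ m"
      by (simp add: power_int_minus divide_inverse)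
    have "q * t1 * t2 = q * A" "q * t1 * t3 = q * B" "q * t1 * t4 = q * C" "t1 * t2 * t3 * t4 = T"
      by (simp_all add: A_def B_def C_def T_def W_def)
    then show ?thesis
      unfolding S_def pw phi43_finite[OF q(1)] sum_distrib_left sig_def theta_def
      by (simp only: qpoch_of_real) (simp add: sum_distrib_left mult_ac)
  qed
  \<comment> \<open>The added term is zero; the range now agrees with that of
    \<open>R_expand\<close>.\<close>
  also have "\<dots> = (\<Sum>k\<le>Suc m. of_real (sig m k) *
      (of_real t1 * (z * (1 - of_real t3 / z) * (1 - of_real t4 / z) * th z k)))"
    by (simp add: sig_eq_0)
  finally have S_sum: "of_real t1 * S q t1 t2 t3 t4 (Suc m) z = \<dots>" .
  have "of_real (?c * t1) * S q t1 t2 t3 t4 (Suc m) z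
      = of_real ?c * (of_real t1 * S q t1 t2 t3 t4 (Suc m) z)"
    by (simp only: of_real_mult mult.assoc)
  also have "\<dots> =
     (\<Sum>k\<le>Suc m. of_real (sig m k * ?c) *
      (of_real t1 * (z * (1 - of_real t3 / z) * (1 - of_real t4 / z) * th z k)))"
    unfolding S_sum sum_distrib_left
    by (intro sum.cong refl) (simp only: of_real_mult mult_ac)
  also have "\<dots> = (\<Sum>k\<le>Suc m. of_real (rho m (Suc k) * (1 - q * q ^ k) * ((1 - B * q ^ k) * (1 - C * q ^ k)) / q ^ k) * th z k
       + of_real (rho m (Suc k) * (1 - q * q ^ k) * (W - q) / q ^ Suc k) * et z k)
       - (\<Sum>k\<le>Suc m. of_real (W * rho m (Suc k) * (1 - q ^ Suc k) / q ^ Suc k) * th z (Suc k))"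
    unfolding sigma_expand[OF q_nonzero assms] sig_rho sum_subtractf[symmetric]
      B_def[symmetric] C_def[symmetric] W_def[symmetric]
    by (intro sum.cong refl)
       (simp only: distrib_left[where 'a = complex] right_diff_distrib[where 'a = complex]
         mult.assoc[symmetric] of_real_mult[symmetric], simp add: mult_ac)
  also have "(\<Sum>k\<le>Suc m. of_real (W * rho m (Suc k) * (1 - q ^ Suc k) / q ^ Suc k) * th z (Suc k))
     = (\<Sum>k\<le>Suc m. of_real (W * rho m k * (1 - q ^ k) / q ^ k) * th z k)"
    by (rule sum_atMost_shift[symmetric]) (simp_all add: rho_eq_0)
  finally show ?thesis unfolding sum_subtractf[symmetric] collect .
qed


section \<open>The sums U and V and the collapse of the coefficients\<close>

abbreviation "D k \<equiv> (1 - B * q ^ k) * (1 - C * q ^ k)"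

definition U :: "nat \<Rightarrow> complex \<Rightarrow> complex" where
  "U n z = (\<Sum>k\<le>n. of_real (tau n k) * (th z k - et z k / of_real (D k)))"

definition V :: "nat \<Rightarrow> complex \<Rightarrow> complex" where
  "V n z = (\<Sum>k\<le>n. of_real (tau n k * q ^ k / D k) * et z k)"

lemma D_nonzero: "D k \<noteq> 0"
  using factor_nonzero[of B k] factor_nonzero[of C k] abs_less_1 by simp

lemma T_factor_nonzero: "1 - T * q ^ m \<noteq> 0"
  using factor_nonzero abs_less_1 by blast

lemma rho_Suc_tau:
  "rho m (Suc k) * (1 - q * q ^ k) * D k
    = (1 - B) * (1 - C) * (1 - T * q ^ m) * q ^ Suc k * (1 - q ^ k / q ^ Suc m) * tau (Suc m) k"
proof -
  have "rho m (Suc k) * (1 - q * q ^ k) * D k * (1 - A * q ^ k)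
      = rho m k * (1 - T * q ^ m * q ^ k) * (1 - q ^ k / q ^ Suc m) * q"
    using rho_Suc[of m k] by (simp only: mult_ac)
  then show ?thesis
    unfolding rho_tau using factor_nonzero[of A k] abs_less_1 by (simp add: mult_ac)
qed

lemma rho_Suc_tau':
  "rho m (Suc k) * (1 - q * q ^ k) * D k
    = (1 - B) * (1 - C) * (1 - 1 / q ^ Suc m) * q ^ Suc k * (1 - T * q ^ m * q ^ k) * tau m k"
proof -
  have "rho m (Suc k) * (1 - q * q ^ k) * D k * (1 - A * q ^ k)
      = rho m k * (1 - q ^ k / q ^ Suc m) * (1 - T * q ^ m * q ^ k) * q"
    using rho_Suc[of m k] by (simp only: mult_ac)
  then show ?thesis
    unfolding rho_tau' using factor_nonzero[of A k] abs_less_1 by (simp add: mult_ac)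
qed

text \<open>Since \<open>T = A * W\<close>, the two \<open>rho m k\<close> terms combine to a
  multiple of \<open>1 - T q^m q^k\<close>. Then everything is a multiple of
  \<open>tau (Suc m) k\<close>, with bracket \<open>(1 - A K) - A q^(m+1) (1 - K / q^(m+1))\<close>,
  from which \<open>K = q^k\<close> cancels.\<close>

lemma X_theta_coeff:
  "rho m k / q ^ k - A * q ^ m / (1 - T * q ^ m) *
     (rho m (Suc k) * (1 - q * q ^ k) * D k / q ^ k - W * rho m k * (1 - q ^ k) / q ^ k)
   = (1 - B) * (1 - C) * (1 - A * q ^ Suc m) * tau (Suc m) k" (is "?L = _")
proof -
  have "?L = (rho m k * (1 - T * q ^ m * q ^ k) - A * q ^ m * (rho m (Suc k) * (1 - q * q ^ k) * D k))
      / (q ^ k * (1 - T * q ^ m))"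
    using T_factor_nonzero[of m] q_power_nonzero[of k] q unfolding T_def
    by (simp add: divide_simps) (simp add: algebra_simps)
  also have "\<dots> = (1 - B) * (1 - C) * (1 - A * q ^ Suc m) * tau (Suc m) k"
    unfolding rho_tau rho_Suc_tau
    using T_factor_nonzero[of m] q_power_nonzero[of k] q
    by (simp add: divide_simps) (simp add: algebra_simps)
  finally show ?thesis .
qed

lemma X_eta_coeff:
  "rho m (Suc k) * (1 - 1 / q ^ Suc k) - A * q ^ m / (1 - T * q ^ m) *
     (rho m (Suc k) * (1 - q * q ^ k) * (W - q) / q ^ Suc k)
   = - ((1 - B) * (1 - C) * (1 - A * q ^ Suc m) * tau (Suc m) k * (1 - q ^ k / q ^ Suc m) / D k)"
  (is "?L = _")
proof -
  have "?L = - ((1 - A * q ^ Suc m) / ((1 - T * q ^ m) * q ^ Suc k)) *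
      (rho m (Suc k) * (1 - q * q ^ k) * D k / D k)"
    unfolding nonzero_mult_div_cancel_right[OF D_nonzero]
    using T_factor_nonzero[of m] q_power_nonzero[of k] q unfolding T_def
    by (simp add: divide_simps) (simp add: algebra_simps)
  also have "\<dots> = - ((1 - B) * (1 - C) * (1 - A * q ^ Suc m) * tau (Suc m) k * (1 - q ^ k / q ^ Suc m) / D k)"
    unfolding rho_Suc_tau using T_factor_nonzero[of m] q_power_nonzero[of "Suc k"] by simp
  finally show ?thesis .
qed

text \<open>Here the \<open>rho m k\<close> terms combine to a multiple of
  \<open>1 - q^k / q^(m+1)\<close>, so the result involves \<open>tau m\<close>; again the
  dependence on \<open>q^k\<close> cancels because \<open>T = A * W\<close>.\<close>

lemma Y_theta_coeff:
  "q ^ m * W * rho m k / q ^ k - 1 / (q * (1 - 1 / q ^ Suc m)) *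
     (rho m (Suc k) * (1 - q * q ^ k) * D k / q ^ k - W * rho m k * (1 - q ^ k) / q ^ k)
   = (1 - B) * (1 - C) * (W * q ^ m - 1) * tau m k" (is "?L = _")
proof -
  have "?L = (q ^ Suc m * W * (rho m k * (1 - q ^ k / q ^ Suc m)) - rho m (Suc k) * (1 - q * q ^ k) * D k)
      / (q ^ Suc k * (1 - 1 / q ^ Suc m))"
    using q_power_Suc_neq_1[of m] q_power_nonzero[of k] q_power_nonzero[of m] q
    by (simp add: divide_simps) (simp add: algebra_simps)
  also have "\<dots> = (1 - B) * (1 - C) * (W * q ^ m - 1) * tau m k"
    unfolding rho_tau' rho_Suc_tau'
    using q_power_Suc_neq_1[of m] q_power_nonzero[of k] q_power_nonzero[of m] q unfolding T_def
    by (simp add: divide_simps) (simp add: algebra_simps)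
  finally show ?thesis .
qed

lemma Y_eta_coeff:
  "q ^ m * W * (rho m (Suc k) * (1 - 1 / q ^ Suc k)) - 1 / (q * (1 - 1 / q ^ Suc m)) *
     (rho m (Suc k) * (1 - q * q ^ k) * (W - q) / q ^ Suc k)
   = - ((1 - B) * (1 - C) * (W * q ^ m - 1) * tau m k * (1 - T * q ^ m * q ^ k) / D k)"
  (is "?L = _")
proof -
  have "?L = - ((W * q ^ m - 1) / ((1 - 1 / q ^ Suc m) * q ^ Suc k)) *
      (rho m (Suc k) * (1 - q * q ^ k) * D k / D k)"
    unfolding nonzero_mult_div_cancel_right[OF D_nonzero]
    using q_power_Suc_neq_1[of m] q_power_nonzero[of k] q_power_nonzero[of m] q
    by (simp add: divide_simps) (simp add: algebra_simps)
  also have "\<dots> = - ((1 - B) * (1 - C) * (W * q ^ m - 1) * tau m k * (1 - T * q ^ m * q ^ k) / D k)"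
    unfolding rho_Suc_tau' using q_power_Suc_neq_1[of m] q_power_nonzero[of "Suc k"] q by simp
  finally show ?thesis .
qed


section \<open>X and Y in terms of U and V\<close>

lemma U_plus_V:
  "U n z + of_real c * V n z =
    (\<Sum>k\<le>n. of_real (tau n k) * th z k - of_real (tau n k * (1 - c * q ^ k) / D k) * et z k)"
  unfolding U_def V_def sum_distrib_left sum.distrib[symmetric]
  by (intro sum.cong refl) (simp add: algebra_simps diff_divide_distrib)

lemma U_V_0: "U 0 z + V 0 z = 1"
  using U_plus_V[of 0 z 1] by (simp add: tau_def theta_def)

lemma R_0: "R q t1 t2 t3 t4 0 z = 1"
  using phi43_finite[OF q(1), of 0] by (simp add: R_def)

text \<open>Degree zero is treated apart because \<open>rho\<close> only covers positive degrees; it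
  is needed for \<open>X (n-1)\<close> at \<open>n = 1\<close>.\<close>

lemma X_eq:
  assumes "z \<noteq> 0"
  shows "X q t1 t2 t3 t4 n z =
    of_real ((1 - B) * (1 - C) * (1 - A * q ^ n)) * (U n z + of_real (1 / q ^ n) * V n z)"
proof (cases n)
  case 0
  then show ?thesis
    using U_V_0[of z] by (simp add: X_def R_0 A_def B_def C_def mult_ac)
next
  case (Suc m)
  \<comment> \<open>Minus the weight of \<open>S\<close> in \<open>X\<close>, relative to the
    normalisation in \<open>S_expand\<close>.\<close>
  let ?c = "A * q ^ m / (1 - T * q ^ m)"
  have "t1\<^sup>2 * t2 * (1 - q ^ Suc m) = - ?c * (q * (1 - 1 / q ^ Suc m) * (1 - T * q ^ m) * t1)"
    using T_factor_nonzero[of m] q by (simp add: A_def divide_simps power2_eq_square) (simp add: algebra_simps)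
  then have "X q t1 t2 t3 t4 (Suc m) z =
      of_real ((1 - A) * (1 - B) * (1 - C)) * R q t1 t2 t3 t4 (Suc m) z
      - of_real ?c * (of_real (q * (1 - 1 / q ^ Suc m) * (1 - T * q ^ m) * t1) * S q t1 t2 t3 t4 (Suc m) z)"
    unfolding X_def A_def[symmetric] B_def[symmetric] C_def[symmetric]
    by (simp only: of_real_mult of_real_minus mult.assoc minus_mult_left[symmetric] diff_conv_add_uminus)
  also have "\<dots> = (\<Sum>k\<le>Suc m.
      of_real (rho m k / q ^ k - ?c * (rho m (Suc k) * (1 - q * q ^ k) * D k / q ^ k
          - W * rho m k * (1 - q ^ k) / q ^ k)) * th z k
      + of_real (rho m (Suc k) * (1 - 1 / q ^ Suc k)
          - ?c * (rho m (Suc k) * (1 - q * q ^ k) * (W - q) / q ^ Suc k)) * et z k)"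
    unfolding R_expand[OF assms] S_expand[OF assms] sum_distrib_left sum_subtractf[symmetric]
      of_real_diff[where 'a = complex] of_real_mult[where 'a = complex, of ?c]
    by (intro sum.cong refl) (simp only: ring_distribs mult.assoc add_diff_add)
  also have "\<dots> = of_real ((1 - B) * (1 - C) * (1 - A * q ^ Suc m)) *
      (U (Suc m) z + of_real (1 / q ^ Suc m) * V (Suc m) z)"
    unfolding X_theta_coeff X_eta_coeff U_plus_V sum_distrib_left
    by (intro sum.cong refl)
       (simp only: right_diff_distrib[where 'a = complex] mult.assoc[symmetric] of_real_mult[symmetric]
         of_real_minus mult_minus_left, simp add: mult_ac)
  finally show ?thesis by (simp add: Suc)
qed

text \<open>The drop from \<open>Suc m\<close> to \<open>m\<close> explains the pairing:
  \<open>Y (-n-1)\<close> belongs with \<open>X n\<close>, and \<open>Y (-n)\<close> with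
  \<open>X (n-1)\<close>.\<close>

lemma Yneg_eq:
  assumes "z \<noteq> 0"
  shows "Yneg q t1 t2 t3 t4 (Suc m) z =
    of_real ((1 - B) * (1 - C) * (W * q ^ m - 1)) * (U m z + of_real (T * q ^ m) * V m z)"
proof -
  let ?c = "1 / (q * (1 - 1 / q ^ Suc m))"
  have "t1 * (1 - t1 * t2 * t3 * t4 * q ^ m) = ?c * (q * (1 - 1 / q ^ Suc m) * (1 - T * q ^ m) * t1)"
    using q_power_Suc_neq_1[of m] q by (simp add: T_def A_def W_def mult_ac)
  then have "Yneg q t1 t2 t3 t4 (Suc m) z =
      of_real (q ^ m * W) * (of_real ((1 - A) * (1 - B) * (1 - C)) * R q t1 t2 t3 t4 (Suc m) z)
      - of_real ?c * (of_real (q * (1 - 1 / q ^ Suc m) * (1 - T * q ^ m) * t1) * S q t1 t2 t3 t4 (Suc m) z)"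
    unfolding Yneg_def A_def[symmetric] B_def[symmetric] C_def[symmetric]
    by (simp only: of_real_mult mult.assoc diff_Suc_1 W_def)
  also have "\<dots> = (\<Sum>k\<le>Suc m.
      of_real (q ^ m * W * rho m k / q ^ k - ?c * (rho m (Suc k) * (1 - q * q ^ k) * D k / q ^ k
          - W * rho m k * (1 - q ^ k) / q ^ k)) * th z k
      + of_real (q ^ m * W * (rho m (Suc k) * (1 - 1 / q ^ Suc k))
          - ?c * (rho m (Suc k) * (1 - q * q ^ k) * (W - q) / q ^ Suc k)) * et z k)"
    unfolding R_expand[OF assms] S_expand[OF assms] sum_distrib_left sum_subtractf[symmetric]
      of_real_diff[where 'a = complex] of_real_mult[where 'a = complex, of ?c]
      of_real_mult[where 'a = complex, of "q ^ m * W"] times_divide_eq_right[symmetric] mult.assoc[of "q ^ m * W"]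
    by (intro sum.cong refl) (simp only: ring_distribs mult.assoc add_diff_add)
  also have "\<dots> = of_real ((1 - B) * (1 - C) * (W * q ^ m - 1)) *
      (\<Sum>k\<le>Suc m. of_real (tau m k) * th z k
        - of_real (tau m k * (1 - T * q ^ m * q ^ k) / D k) * et z k)"
    unfolding Y_theta_coeff Y_eta_coeff sum_distrib_left
    by (intro sum.cong refl) (simp add: algebra_simps)
  also have "(\<Sum>k\<le>Suc m. of_real (tau m k) * th z k
        - of_real (tau m k * (1 - T * q ^ m * q ^ k) / D k) * et z k)
      = U m z + of_real (T * q ^ m) * V m z"
    unfolding U_plus_V by (simp add: tau_eq_0)
  finally show ?thesis .
qed


section \<open>Multiplication by z on U and V\<close>

lemma tau_Suc:
  "tau (Suc m) (Suc k) * ((1 - q * q ^ k) * (1 - A * q ^ Suc k))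
    = tau (Suc m) k * (1 - q ^ k / q ^ Suc m) / D k * (1 - T * q ^ m * q ^ Suc k)"
  using factor_nonzero[of q k] factor_nonzero[of A "Suc k"] factor_nonzero[of B k] factor_nonzero[of C k]
    abs_less_1 q
  by (simp add: tau_def rpoch_Suc mult_ac)

lemma tau_pred:
  "tau m k * ((1 - 1 / q ^ Suc m) * (1 - T * q ^ m * q ^ k))
    = tau (Suc m) k * ((1 - q ^ k / q ^ Suc m) * (1 - T * q ^ m))"
proof -
  have "rpoch q (1 / q ^ m) k * (1 - 1 / q ^ Suc m) * (rpoch q (T * q ^ m) k * (1 - T * q ^ m * q ^ k))
     = rpoch q (1 / q ^ Suc m) k * (1 - q ^ k / q ^ Suc m) * ((1 - T * q ^ m) * rpoch q (T * q ^ Suc m) k)"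
    unfolding rpoch_N_shift rpoch_T_shift by (simp only: mult_ac)
  then show ?thesis by (simp add: tau_def mult_ac)
qed

lemma T_power_mult_power_neq_1: "T * q ^ m * q ^ k \<noteq> 1"
  using factor_nonzero[of T "m + k"] abs_less_1 by (simp add: power_add mult.assoc)

lemma T_power_neq_inverse_power: "T * q ^ m \<noteq> 1 / q ^ k"
  using T_power_mult_power_neq_1[of m k] q by (simp add: nonzero_eq_divide_eq)

text \<open>The two affine functions have distinct slopes and the same value at
  \<open>K = 0\<close>, so they are independent; \<open>y\<close> below solves the resulting linear
  system.\<close>

lemma affine_decomposition:
  "\<exists>x y. \<forall>K. p + r * K = x * (1 - T * q ^ m * K) + y * (1 - K / q ^ k)"
proof -
  let ?d = "1 / q ^ k - T * q ^ m"
  have d: "?d \<noteq> 0" using T_power_neq_inverse_power[of m k] by simp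
  define y where "y = - (r + p * (T * q ^ m)) / ?d"
  have "y * ?d = - (r + p * (T * q ^ m))" using d by (simp add: y_def)
  then have e: "y / q ^ k = y * (T * q ^ m) - (r + p * (T * q ^ m))"
    by (simp add: algebra_simps)
  have "y * (1 - K / q ^ k) = y - K * (y / q ^ k)" for K
    by (simp add: right_diff_distrib)
  then have "p + r * K = (p - y) * (1 - T * q ^ m * K) + y * (1 - K / q ^ k)" for K
    unfolding e by (simp add: algebra_simps)
  then show ?thesis by blast
qed

lemma mult_U_plus_V:
  assumes "z \<noteq> 0"
  shows "of_real t1 * z * (U (Suc m) z + of_real (1 / q ^ Suc m) * V (Suc m) z) =
    (\<Sum>k\<le>Suc m. of_real (tau (Suc m) k / (1 - T * q ^ m * q ^ k) * (1 + A - T * q ^ m - A * q ^ k))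
        * (th z k - et z k)
      - of_real (tau (Suc m) k * (1 - q ^ k / q ^ Suc m) / D k * (t1\<^sup>2 * q * q ^ k)) * et z k)"
proof -
  let ?n = "\<lambda>k. tau (Suc m) k * (1 - q ^ k / q ^ Suc m) / D k"
  \<comment> \<open>\<open>?g\<close> is chosen so that
    \<open>?g (Suc k) = ?n k / q ^ Suc k\<close>, by \<open>tau_Suc\<close>; its factor
    \<open>1 - q ^ k\<close> gives \<open>?g 0 = 0\<close>.\<close>
  let ?g = "\<lambda>k. tau (Suc m) k * ((1 - q ^ k) * (1 - A * q ^ k)) / ((1 - T * q ^ m * q ^ k) * q ^ k)"
  have nz: "1 - T * q ^ m * q ^ k \<noteq> 0" for k
    using T_power_mult_power_neq_1[of m k] by simp
  have g: "?g (Suc k) = ?n k / q ^ Suc k" for k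
    using tau_Suc[of m k] nz[of "Suc k"] q_power_nonzero[of "Suc k"]
    by (simp add: frac_eq_eq divide_divide_eq_left mult_ac)
  have shift: "(\<Sum>k\<le>Suc m. of_real (?n k / q ^ Suc k) * (th z (Suc k) - et z (Suc k)))
     = (\<Sum>k\<le>Suc m. of_real (?g k) * (th z k - et z k))"
    unfolding g[symmetric] by (rule sum_atMost_shift[symmetric]) (simp_all add: tau_eq_0)
  \<comment> \<open>With \<open>s = T q^m\<close>,
    \<open>(1 - s K) - (1 - K) (1 - A K) = K (1 + A - s - A K)\<close>, which cancels the
    denominator \<open>q ^ k\<close>.\<close>
  have coeff: "tau (Suc m) k / q ^ k - ?g k
     = tau (Suc m) k / (1 - T * q ^ m * q ^ k) * (1 + A - T * q ^ m - A * q ^ k)" for k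
    using nz[of k] q_power_nonzero[of k] q by (simp add: divide_simps) (simp add: algebra_simps)
  have collect: "of_real x * ((h - e) / of_real k) - of_real y * (of_real u * e + (h' - e') / of_real l)
      = of_real (x / k) * (h - e) - of_real (y * u) * e - of_real (y / l) * (h' - e')"
    for x y u k l :: real and h e h' e' :: complex
    by (simp add: distrib_left)
  have collect': "of_real x * h - e - of_real y * h = of_real (x - y) * h - e"
    for x y :: real and h e :: complex
    by (simp add: left_diff_distrib)
  have "of_real t1 * z * (U (Suc m) z + of_real (1 / q ^ Suc m) * V (Suc m) z)
    = (\<Sum>k\<le>Suc m. of_real (tau (Suc m) k) * (of_real t1 * z * th z k)
         - of_real (?n k) * (of_real t1 * z * et z k))"
    unfolding U_plus_V sum_distrib_left
    by (intro sum.cong refl) (simp add: right_diff_distrib mult_ac)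
  also have "\<dots> = (\<Sum>k\<le>Suc m. of_real (tau (Suc m) k / q ^ k) * (th z k - et z k)
         - of_real (?n k * (t1\<^sup>2 * q * q ^ k)) * et z k)
      - (\<Sum>k\<le>Suc m. of_real (?n k / q ^ Suc k) * (th z (Suc k) - et z (Suc k)))"
    unfolding mult_theta[OF q_nonzero] mult_eta[OF q_nonzero assms] sum_subtractf[symmetric]
    by (intro sum.cong refl collect)
  also have "\<dots> = (\<Sum>k\<le>Suc m. of_real (tau (Suc m) k / q ^ k - ?g k) * (th z k - et z k)
         - of_real (?n k * (t1\<^sup>2 * q * q ^ k)) * et z k)"
    unfolding shift sum_subtractf[symmetric] by (intro sum.cong refl collect')
  finally show ?thesis unfolding coeff .
qed

text \<open>Matching \<open>theta\<close> coefficients determines \<alpha> and \<gamma>, matching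
  \<open>eta\<close> coefficients then determines \<beta> and \<delta>; by \<open>tau_pred\<close>
  both conditions are affine identities in \<open>K = q^k\<close>.\<close>

lemma mult_U_plus_V_span:
  "\<exists>\<alpha> \<beta> \<gamma> \<delta> :: real. \<forall>z. z \<noteq> 0 \<longrightarrow>
    of_real t1 * z * (U (Suc m) z + of_real (1 / q ^ Suc m) * V (Suc m) z) =
      of_real \<alpha> * U (Suc m) z + of_real \<beta> * V (Suc m) z + of_real \<gamma> * U m z + of_real \<delta> * V m z"
proof -
  let ?s = "T * q ^ m"
  obtain \<alpha> \<gamma> where \<alpha>\<gamma>: "\<And>K. 1 + A - ?s + (- A) * K = \<alpha> * (1 - ?s * K) + \<gamma> * (1 - K / q ^ Suc m)"
    using affine_decomposition[of "1 + A - ?s" "- A" m "Suc m"] by blast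
  \<comment> \<open>The left side is what remains of the \<open>eta\<close> condition after
    multiplying by \<open>D k\<close>, removing the part matched by \<alpha> and \<gamma>, and
    dividing by \<open>K\<close>.\<close>
  obtain \<beta> \<delta> where \<beta>\<delta>: "\<And>K. ((B + C) * (1 + A - ?s) - t1\<^sup>2 * q) +
      (t1\<^sup>2 * q * (1 / q ^ Suc m + ?s) - A * (B + C) - B * C * (1 + A - ?s)) * K
      = \<beta> * (1 - ?s * K) + \<delta> * (1 - K / q ^ Suc m)"
    using affine_decomposition[of "(B + C) * (1 + A - ?s) - t1\<^sup>2 * q"
        "t1\<^sup>2 * q * (1 / q ^ Suc m + ?s) - A * (B + C) - B * C * (1 + A - ?s)" m "Suc m"]
    by blast
  let ?r = "(1 - 1 / q ^ Suc m) / (1 - ?s)"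
  have nz: "1 - ?s * q ^ k \<noteq> 0" for k
    using T_power_mult_power_neq_1[of m k] by simp
  have tau_m: "?r * tau m k = tau (Suc m) k / (1 - ?s * q ^ k) * (1 - q ^ k / q ^ Suc m)" for k
  proof -
    have "a / c * y = x / b * f" if "y * (a * b) = x * (f * c)" "c \<noteq> 0" "b \<noteq> 0" for a b c f x y :: real
      using that by (simp add: frac_eq_eq mult_ac)
    from this[OF tau_pred T_factor_nonzero nz] show ?thesis .
  qed
  have th_coeff: "tau (Suc m) k / (1 - ?s * q ^ k) * (1 + A - ?s - A * q ^ k)
      = \<alpha> * tau (Suc m) k + \<gamma> * (?r * tau m k)" for k
  proof -
    have "tau (Suc m) k / (1 - ?s * q ^ k) * (1 + A - ?s - A * q ^ k)
       = tau (Suc m) k / (1 - ?s * q ^ k) * (\<alpha> * (1 - ?s * q ^ k) + \<gamma> * (1 - q ^ k / q ^ Suc m))"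
      using \<alpha>\<gamma>[of "q ^ k"] by simp
    also have "\<dots> = \<alpha> * tau (Suc m) k + \<gamma> * (?r * tau m k)"
      unfolding tau_m using nz[of k] by (simp add: distrib_left)
    finally show ?thesis .
  qed
  \<comment> \<open>This makes the quadratic terms in \<open>K\<close> of the \<open>eta\<close>
    condition cancel, leaving an affine function.\<close>
  have uT: "t1\<^sup>2 * T = A * (B * C)"
    by (simp add: T_def A_def B_def C_def W_def power2_eq_square)
  have et_coeff: "- (tau (Suc m) k / (1 - ?s * q ^ k) * (1 + A - ?s - A * q ^ k))
      - tau (Suc m) k * (1 - q ^ k / q ^ Suc m) / D k * (t1\<^sup>2 * q * q ^ k)
    = - (\<alpha> * tau (Suc m) k + \<gamma> * (?r * tau m k)) / D k
      + (\<beta> * tau (Suc m) k + \<delta> * (?r * tau m k)) * q ^ k / D k" for k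
  proof -
    let ?K = "q ^ k"
    have "t1\<^sup>2 * q * ((1 - ?K / q ^ Suc m) * (1 - ?s * ?K))
       = t1\<^sup>2 * q - t1\<^sup>2 * q * (1 / q ^ Suc m + ?s) * ?K + t1\<^sup>2 * T * ?K * ?K"
      using q by (simp add: divide_simps) (simp add: algebra_simps)
    then have *: "(B + C - B * C * ?K) * (1 + A - ?s - A * ?K)
         - t1\<^sup>2 * q * ((1 - ?K / q ^ Suc m) * (1 - ?s * ?K))
       = \<beta> * (1 - ?s * ?K) + \<delta> * (1 - ?K / q ^ Suc m)"
      unfolding uT \<beta>\<delta>[symmetric] by (simp add: algebra_simps)
    have "- (tau (Suc m) k / (1 - ?s * ?K) * (1 + A - ?s - A * ?K))
      - tau (Suc m) k * (1 - ?K / q ^ Suc m) / D k * (t1\<^sup>2 * q * ?K)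
      = tau (Suc m) k / (1 - ?s * ?K) * (?K * ((B + C - B * C * ?K) * (1 + A - ?s - A * ?K)
         - t1\<^sup>2 * q * ((1 - ?K / q ^ Suc m) * (1 - ?s * ?K))) - (1 + A - ?s - A * ?K)) / D k"
    proof -
      \<comment> \<open>Applied with \<open>g = B + C - B C K\<close>, for which
        \<open>D k = 1 - K g\<close>.\<close>
      have "- (x / y * a) - x * f / d * (u * K) = x / y * (K * (g * a - u * (f * y)) - a) / d"
        if "d = 1 - K * g" "y \<noteq> 0" "d \<noteq> 0" for x y a f d u K g :: real
      proof -
        have e: "K * (g * a - u * (f * y)) - a = - (d * a) - K * u * f * y"
          by (simp add: that(1) algebra_simps)
        show ?thesis
          unfolding e using that(2,3) by (simp add: field_simps)
      qed
      from this[OF _ nz D_nonzero] show ?thesis by this (simp add: algebra_simps)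
    qed
    also have "\<dots> = tau (Suc m) k / (1 - ?s * ?K) * ((\<beta> * (1 - ?s * ?K) + \<delta> * (1 - ?K / q ^ Suc m)) * ?K
        - (\<alpha> * (1 - ?s * ?K) + \<gamma> * (1 - ?K / q ^ Suc m))) / D k"
      unfolding * \<alpha>\<gamma>[symmetric] by (simp add: mult.commute)
    also have "\<dots> = - (\<alpha> * tau (Suc m) k + \<gamma> * (?r * tau m k)) / D k
      + (\<beta> * tau (Suc m) k + \<delta> * (?r * tau m k)) * ?K / D k"
    proof -
      have "x / y * ((\<beta> * y + \<delta> * f) * K - (\<alpha> * y + \<gamma> * f)) / d
        = - (\<alpha> * x + \<gamma> * (x / y * f)) / d + (\<beta> * x + \<delta> * (x / y * f)) * K / d"
        if "y \<noteq> 0" for x y f K d :: real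
      proof -
        have "x / y * ((\<beta> * y + \<delta> * f) * K - (\<alpha> * y + \<gamma> * f))
          = (\<beta> * x + \<delta> * (x / y * f)) * K - (\<alpha> * x + \<gamma> * (x / y * f))"
          using that by (simp add: field_simps)
        then show ?thesis by (simp only: diff_divide_distrib minus_divide_left[symmetric])
      qed
      then show ?thesis unfolding tau_m using nz[of k] .
    qed
    finally show ?thesis .
  qed
  \<comment> \<open>\<open>tau m\<close> vanishes at \<open>Suc m\<close>, so all four sums can
    share one range.\<close>
  have ext: "U m z = (\<Sum>k\<le>Suc m. of_real (tau m k) * (th z k - et z k / of_real (D k)))"
    "V m z = (\<Sum>k\<le>Suc m. of_real (tau m k * q ^ k / D k) * et z k)" for z
    by (simp_all add: U_def V_def tau_eq_0)
  have "of_real t1 * z * (U (Suc m) z + of_real (1 / q ^ Suc m) * V (Suc m) z) =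
      of_real \<alpha> * U (Suc m) z + of_real \<beta> * V (Suc m) z
      + of_real (\<gamma> * ?r) * U m z + of_real (\<delta> * ?r) * V m z" if "z \<noteq> 0" for z
  proof -
    have "of_real t1 * z * (U (Suc m) z + of_real (1 / q ^ Suc m) * V (Suc m) z) =
      (\<Sum>k\<le>Suc m. of_real (\<alpha> * tau (Suc m) k + \<gamma> * (?r * tau m k)) * th z k
        + of_real (- (\<alpha> * tau (Suc m) k + \<gamma> * (?r * tau m k)) / D k
           + (\<beta> * tau (Suc m) k + \<delta> * (?r * tau m k)) * q ^ k / D k) * et z k)"
      unfolding mult_U_plus_V[OF that] et_coeff[symmetric] unfolding th_coeff[symmetric]
      by (intro sum.cong refl)
        (simp only: of_real_diff of_real_minus right_diff_distrib[where 'a = complex]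
          left_diff_distrib[where 'a = complex] mult_minus_left, simp)
    also have "\<dots> = of_real \<alpha> * U (Suc m) z + of_real \<beta> * V (Suc m) z
      + of_real (\<gamma> * ?r) * U m z + of_real (\<delta> * ?r) * V m z"
      unfolding ext U_def[of "Suc m"] V_def[of "Suc m"] sum_distrib_left sum.distrib[symmetric]
    proof (intro sum.cong refl)
      fix k
      show "of_real (\<alpha> * tau (Suc m) k + \<gamma> * (?r * tau m k)) * th z k
        + of_real (- (\<alpha> * tau (Suc m) k + \<gamma> * (?r * tau m k)) / D k
           + (\<beta> * tau (Suc m) k + \<delta> * (?r * tau m k)) * q ^ k / D k) * et z k
        = of_real \<alpha> * (of_real (tau (Suc m) k) * (th z k - et z k / of_real (D k)))
          + of_real \<beta> * (of_real (tau (Suc m) k * q ^ k / D k) * et z k)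
          + of_real (\<gamma> * ?r) * (of_real (tau m k) * (th z k - et z k / of_real (D k)))
          + of_real (\<delta> * ?r) * (of_real (tau m k * q ^ k / D k) * et z k)"
      proof -
        have "of_real (\<alpha> * x + \<gamma> * (r * y)) * h + of_real (- (\<alpha> * x + \<gamma> * (r * y)) / d
             + (\<beta> * x + \<delta> * (r * y)) * K / d) * e
          = of_real \<alpha> * (of_real x * (h - e / of_real d)) + of_real \<beta> * (of_real (x * K / d) * e)
            + of_real (\<gamma> * r) * (of_real y * (h - e / of_real d))
            + of_real (\<delta> * r) * (of_real (y * K / d) * e)" for x y r d K :: real and h e :: complex
          by (simp add: algebra_simps add_divide_distrib diff_divide_distrib)
        then show ?thesis .
      qed
    qed
    finally show ?thesis .
  qed
  then show ?thesis by blast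
qed

end

section \<open>The four-term relation\<close>

lemma two_term_change_of_basis:
  fixes x y \<kappa> \<mu> \<alpha> \<beta> :: real
  assumes "x \<noteq> 0" "y \<noteq> 0" "\<kappa> \<noteq> \<mu>"
  shows "\<exists>a b :: real. \<forall>u v :: complex.
    of_real \<alpha> * u + of_real \<beta> * v =
      of_real a * (of_real y * (u + of_real \<kappa> * v)) + of_real b * (of_real x * (u + of_real \<mu> * v))"
proof -
  \<comment> \<open>Cramer's rule for the coefficients of \<open>u\<close> and \<open>v\<close>; the
    determinant is nonzero because \<kappa> and \<mu> differ.\<close>
  define a where "a = (\<beta> - \<alpha> * \<mu>) / (y * (\<kappa> - \<mu>))"
  define b where "b = (\<alpha> * \<kappa> - \<beta>) / (x * (\<kappa> - \<mu>))"
  have "a * y + b * x = \<alpha>" "a * y * \<kappa> + b * x * \<mu> = \<beta>"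
    unfolding a_def b_def using assms by (simp_all add: divide_simps) (simp_all add: algebra_simps)
  then have "of_real \<alpha> * u + of_real \<beta> * v =
      of_real a * (of_real y * (u + of_real \<kappa> * v)) + of_real b * (of_real x * (u + of_real \<mu> * v))"
    for u v :: complex
    by (auto simp: algebra_simps)
  then show ?thesis by blast
qed

theorem proposition4p9:
  fixes q t1 t2 t3 t4 :: real and n :: nat
  assumes "0 < q" and "q < 1"
    and "\<bar>t1\<bar> < 1" and "\<bar>t2\<bar> < 1" and "\<bar>t3\<bar> < 1" and "\<bar>t4\<bar> < 1"
    and "n \<ge> 1"
  shows "\<exists>a b c d :: real. \<forall>z :: complex. z \<noteq> 0 \<longrightarrow>
    z * X q t1 t2 t3 t4 n z =
      of_real a * Yneg q t1 t2 t3 t4 (n + 1) z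
      + of_real b * X q t1 t2 t3 t4 n z
      + of_real c * Yneg q t1 t2 t3 t4 n z
      + of_real d * X q t1 t2 t3 t4 (n - 1) z"
proof (cases "t1 = 0")
  case True
  then show ?thesis
    using X_eq_0[OF assms(1,2,7)] by (intro exI[of _ 0]) simp
next
  case False
  interpret aw_params q t1 t2 t3 t4
    by unfold_locales (fact assms)+
  obtain m where n: "n = Suc m" using assms(7) by (cases n) auto
  define x where "x k = (1 - B) * (1 - C) * (1 - A * q ^ k)" for k
  define y where "y k = (1 - B) * (1 - C) * (W * q ^ k - 1)" for k
  have x: "x k \<noteq> 0" and y: "y k \<noteq> 0" for k
    using factor_nonzero[of A k] factor_nonzero[of W k] abs_less_1 by (auto simp: x_def y_def)
  have X: "X q t1 t2 t3 t4 k z = of_real (x k) * (U k z + of_real (1 / q ^ k) * V k z)"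
    and Y: "Yneg q t1 t2 t3 t4 (Suc k) z = of_real (y k) * (U k z + of_real (T * q ^ k) * V k z)"
    if "z \<noteq> 0" for k z
    unfolding x_def y_def by (rule X_eq[OF that] Yneg_eq[OF that])+
  obtain \<alpha> \<beta> \<gamma> \<delta> where span: "\<And>z. z \<noteq> 0 \<Longrightarrow>
    of_real t1 * z * (U n z + of_real (1 / q ^ n) * V n z) =
      of_real \<alpha> * U n z + of_real \<beta> * V n z + (of_real \<gamma> * U m z + of_real \<delta> * V m z)"
    using mult_U_plus_V_span[of m] unfolding n by (auto simp: add.assoc)
  \<comment> \<open>Applied at \<open>n\<close> and at \<open>m\<close>: in each case
    \<open>U\<close> and \<open>V\<close> are exchanged for the pair \<open>Y\<close>,
    \<open>X\<close> at that index.\<close>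
  note basis = two_term_change_of_basis[OF x y T_power_neq_inverse_power]
  obtain a b where ab: "\<And>u v :: complex. of_real \<alpha> * u + of_real \<beta> * v =
      of_real a * (of_real (y n) * (u + of_real (T * q ^ n) * v))
      + of_real b * (of_real (x n) * (u + of_real (1 / q ^ n) * v))"
    using basis by blast
  obtain c d where cd: "\<And>u v :: complex. of_real \<gamma> * u + of_real \<delta> * v =
      of_real c * (of_real (y m) * (u + of_real (T * q ^ m) * v))
      + of_real d * (of_real (x m) * (u + of_real (1 / q ^ m) * v))"
    using basis by blast
  \<comment> \<open>Restores the weight of \<open>X n\<close> and removes the factor
    \<open>t1\<close> carried by the span relation.\<close>
  let ?f = "x n / t1"
  have "z * X q t1 t2 t3 t4 n z =
      of_real (?f * a) * Yneg q t1 t2 t3 t4 (n + 1) z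
      + of_real (?f * b) * X q t1 t2 t3 t4 n z
      + of_real (?f * c) * Yneg q t1 t2 t3 t4 n z
      + of_real (?f * d) * X q t1 t2 t3 t4 (n - 1) z" if z: "z \<noteq> 0" for z
  proof -
    have "z * X q t1 t2 t3 t4 n z
        = of_real ?f * (of_real t1 * z * (U n z + of_real (1 / q ^ n) * V n z))"
      using False by (simp add: X[OF z])
    also have "\<dots> = of_real ?f * (of_real a * Yneg q t1 t2 t3 t4 (Suc n) z
        + of_real b * X q t1 t2 t3 t4 n z
        + (of_real c * Yneg q t1 t2 t3 t4 (Suc m) z + of_real d * X q t1 t2 t3 t4 m z))"
      unfolding span[OF z] ab cd X[OF z] Y[OF z] ..
    finally show ?thesis
      by (simp only: n Suc_eq_plus1[symmetric] diff_Suc_1 distrib_left of_real_mult mult.assoc add.assoc)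
  qed
  then show ?thesis by blast
qed

end
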